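(* Assume that $0$ is not an eigenvalue of $\mathcal{H}$. Let $$\phi(\theta)=\sum_{l=0}^{N}q_l\,T_l\!\left(\frac{\theta}{\tau_K}\right),\qquad \theta\in[-\tau_K,\tau_K],$$ with $q_l\in\mathbb{R}^{2n}$ for $l=0,\dots,N$. Then $$\varphi(\theta):=(\mathcal{R}_0^{-1}\phi)(\theta)=\sum_{l=0}^{N+2}v_l\,T_l\!\left(\frac{\theta}{\tau_K}\right),$$ in which the coefficient vectors $v_2,\dots,v_{N+2}$ follow from $$\begin{bmatrix}v_2&\cdots&v_{N+2}\end{bmatrix}=\tau_K^2\begin{bmatrix}q_0&\cdots&q_N\end{bmatrix}Z_N,$$ where $Z_N\in\mathbb{R}^{(N+1)\times(N+1)}$ is the banded matrix defined in the context, while $v_1$ and $v_0$ follow from $$M(0)\,v_1=\sum_{l=2}^{N+2}\left(H_0T_l'(0)+\sum_{k=1}^K\left(H_kT_l'\!\left(\tfrac{\tau_k}{\tau_K}\right)+H_{-k}T_l'\!\left(\tfrac{-\tau_k}{\tau_K}\right)\right)-I_{2n}\frac{T_l''(0)}{\tau_K}\right)v_l$$ and $$M(0)\,v_0=\sum_{l=1}^{N+2}\left(H_0T_l(0)+\sum_{k=1}^K\left(H_kT_l\!\left(\tfrac{\tau_k}{\tau_K}\right)+H_{-k}T_l\!\left(\tfrac{-\tau_k}{\tau_K}\right)\right)-I_{2n}\frac{T_l'(0)}{\tau_K}\right)v_l.$$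
   Context: Let $n,K$ be positive integers, $0<\tau_1<\dots<\tau_K<\infty$, and let $H_0,H_1,H_{-1},\dots,H_K,H_{-K}\in\mathbb{R}^{2n\times 2n}$. Let $J=\begin{bmatrix}0&I_n\\-I_n&0\end{bmatrix}$. Standing assumption: $(JH_0)^{\top}=JH_0$ and $(JH_{-k})^{\top}=JH_k$ for $k=1,\dots,K$. The characteristic matrix is $M(\lambda)=\lambda I_{2n}-H_0-\sum_{k=1}^K(H_{-k}e^{-\lambda\tau_k}+H_ke^{\lambda\tau_k})$. Let $X=C([-\tau_K,\tau_K],\mathbb{C}^{2n})$. The operator $\mathcal{H}:D(\mathcal{H})\subseteq X\to X$ is $\mathcal{H}\varphi=\varphi'$ with $$D(\mathcal{H})=\Big\{\varphi\in X:\varphi'\in X,\ \varphi'(0)=H_0\varphi(0)+\sum_{k=1}^K\big(H_{-k}\varphi(-\tau_k)+H_k\varphi(\tau_k)\big)\Big\}.$$ The operator $\mathcal{R}_0=\mathcal{H}^2$ acts as $\mathcal{R}_0\varphi=\varphi''$ with domain $D(\mathcal{R}_0)$ consisting of all $\varphi\in X$ with $\varphi',\varphi''\in X$ satisfying $$\varphi'(0)=H_0\varphi(0)+\sum_{k=1}^K\big(H_{-k}\varphi(-\tau_k)+H_k\varphi(\tau_k)\big),\qquad \varphi''(0)=H_0\varphi'(0)+\sum_{k=1}^K\big(H_{-k}\varphi'(-\tau_k)+H_k\varphi'(\tau_k)\big).$$ If $0$ is not an eigenvalue of $\mathcal{H}$ then $M(0)$ is nonsingular and $\mathcal{R}_0:D(\mathcal{R}_0)\to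 X$ is invertible. $T_l$ is the $l$th Chebyshev polynomial of the first kind, $T_l(\cos x)=\cos(lx)$; $T_l',T_l''$ are its derivatives. $N\ge 0$ is an integer. Matrix $Z_N$: index its rows by $l=0,\dots,N$ (row $l$ multiplies $q_l$) and its columns by $j=2,\dots,N+2$ (column $j$ gives $v_j$). Its only nonzero entries are (for those row indices with $l\le N$): $(Z_N)_{0,2}=\frac14$; $(Z_N)_{1,3}=\frac1{24}$; $(Z_N)_{2,2}=-\frac16$, $(Z_N)_{2,4}=\frac1{48}$; and for $l\ge3$: $(Z_N)_{l,l+2}=\frac{1}{4(l+1)(l+2)}$, $(Z_N)_{l,l}=-\frac{1}{2(l-1)(l+1)}$, and, if $l\ge4$, $(Z_N)_{l,l-2}=\frac{1}{4(l-1)(l-2)}$. *)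

theory Defs
  imports "HOL-Analysis.Analysis" "HOL-Computational_Algebra.Polynomial"
begin

section \<open>Chebyshev polynomials of the first kind\<close>

definition cheb :: "nat \<Rightarrow> real poly" where
  "cheb l = (THE p. \<forall>x. poly p (cos x) = cos (real l * x))"

lemma cheb_exists: "\<exists>p :: real poly. \<forall>x. poly p (cos x) = cos (real l * x)"
proof (induction l rule: less_induct)
  case (less l)
  consider "l = 0" | "l = 1" | m where "l = Suc (Suc m)"
    by (metis One_nat_def not0_implies_Suc)
  then show ?case
  proof cases
    case 1
    then show ?thesis by (intro exI[of _ 1]) simp
  next
    case 2
    then show ?thesis by (intro exI[of _ "[:0, 1:]"]) simp
  next
    case 3
    obtain p where p: "\<forall>x. poly p (cos x) = cos (real m * x)"
      using less.IH[of m] 3 by auto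
    obtain r where r: "\<forall>x. poly r (cos x) = cos (real (Suc m) * x)"
      using less.IH[of "Suc m"] 3 by auto
    have "poly ([:0, 2:] * r - p) (cos x) = cos (real l * x)" for x
    proof -
      have a: "real l * x = real (Suc m) * x + x" and b: "real m * x = real (Suc m) * x - x"
        using 3 by (simp_all add: algebra_simps)
      have "poly ([:0, 2:] * r - p) (cos x)
              = 2 * cos x * cos (real (Suc m) * x) - cos (real m * x)"
        using p r by simp
      also have "\<dots> = cos (real l * x)"
        unfolding a b cos_add cos_diff by (simp add: algebra_simps)
      finally show ?thesis .
    qed
    then show ?thesis by blast
  qed
qed

lemma cheb_unique:
  fixes p q :: "real poly"
  assumes "\<And>x. poly p (cos x) = poly q (cos x)"
  shows "p = q"
proof (rule ccontr)
  assume "p \<noteq> q"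
  then have "finite {y. poly (p - q) y = 0}" by (intro poly_roots_finite) simp
  moreover have "{-1..1} \<subseteq> {y. poly (p - q) y = 0}"
    using assms by (auto, metis cos_arccos)
  ultimately have "finite {-1..1::real}" by (rule finite_subset[rotated])
  then show False by (simp add: infinite_Icc)
qed

lemma cheb_cos: "poly (cheb l) (cos x) = cos (real l * x)"
proof -
  have "\<exists>!p :: real poly. \<forall>x. poly p (cos x) = cos (real l * x)"
    using cheb_exists[of l] by (auto intro: cheb_unique)
  from theI'[OF this] show ?thesis by (simp add: cheb_def)
qed


section \<open>Real matrices and vectors acting in the complexification\<close>

definition cvec :: "real^'m \<Rightarrow> complex^'m" where
  "cvec x = (\<chi> i. complex_of_real (x $ i))"

abbreviation cmat :: "real^'m^'m \<Rightarrow> complex^'m^'m" where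
  "cmat A \<equiv> map_matrix complex_of_real A"

text \<open>\<open>\<real>\<^sup>2\<^sup>n\<close> is \<open>real^('n + 'n)\<close>; the two summands index the two blocks.\<close>

definition symplJ :: "real^('n::finite + 'n)^('n + 'n)" where
  "symplJ = (\<chi> i j. case (i, j) of
      (Inl a, Inr b) \<Rightarrow> if a = b then 1 else 0
    | (Inr a, Inl b) \<Rightarrow> if a = b then - 1 else 0
    | _ \<Rightarrow> 0)"


section \<open>The characteristic matrix and the operators\<close>

text \<open>
  The data are \<open>K\<close>, the delays \<open>\<tau> 1, \<dots>, \<tau> K\<close> and the matrices \<open>H j\<close> for \<open>j \<in> {-K..K}\<close>;
  other values of \<open>\<tau>\<close> and \<open>H\<close> are never used.
\<close>

definition charM ::
  "nat \<Rightarrow> (nat \<Rightarrow> real) \<Rightarrow> (int \<Rightarrow> real^'m^'m) \<Rightarrow> complex \<Rightarrow> complex^'m^'m" where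
  "charM K \<tau> H z = mat z - cmat (H 0)
     - (\<Sum>k=1..K. map_matrix ((*) (exp (- z * complex_of_real (\<tau> k)))) (cmat (H (- int k)))
              + map_matrix ((*) (exp (z * complex_of_real (\<tau> k)))) (cmat (H (int k))))"

text \<open>
  \<open>C([-r,r])\<close>: members are extensional (\<open>undefined\<close> outside the interval), so that
  equality of HOL functions is equality in the function space.
\<close>

definition CX :: "real \<Rightarrow> (real \<Rightarrow> complex^'m) set" where
  "CX r = {\<phi> \<in> extensional {-r..r}. continuous_on {-r..r} \<phi>}"

text \<open>Derivative on \<open>[-r,r]\<close>, one-sided at the end points.\<close>

definition Dint :: "real \<Rightarrow> (real \<Rightarrow> complex^'m) \<Rightarrow> real \<Rightarrow> complex^'m" where
  "Dint r \<phi> = (\<lambda>\<theta>\<in>{-r..r}. vector_derivative \<phi> (at \<theta> within {-r..r}))"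

definition CX1 :: "real \<Rightarrow> (real \<Rightarrow> complex^'m) set" where
  "CX1 r = {\<phi> \<in> CX r. (\<forall>\<theta>\<in>{-r..r}. \<phi> differentiable (at \<theta> within {-r..r})) \<and> Dint r \<phi> \<in> CX r}"

definition bcond ::
  "nat \<Rightarrow> (nat \<Rightarrow> real) \<Rightarrow> (int \<Rightarrow> real^'m^'m) \<Rightarrow> (real \<Rightarrow> complex^'m) \<Rightarrow> complex^'m" where
  "bcond K \<tau> H \<phi> = cmat (H 0) *v \<phi> 0
     + (\<Sum>k=1..K. cmat (H (- int k)) *v \<phi> (- \<tau> k) + cmat (H (int k)) *v \<phi> (\<tau> k))"

definition domH ::
  "nat \<Rightarrow> (nat \<Rightarrow> real) \<Rightarrow> (int \<Rightarrow> real^'m^'m) \<Rightarrow> (real \<Rightarrow> complex^'m) set" where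
  "domH K \<tau> H = {\<phi> \<in> CX1 (\<tau> K). Dint (\<tau> K) \<phi> 0 = bcond K \<tau> H \<phi>}"

definition opH :: "nat \<Rightarrow> (nat \<Rightarrow> real) \<Rightarrow> (real \<Rightarrow> complex^'m) \<Rightarrow> real \<Rightarrow> complex^'m" where
  "opH K \<tau> \<phi> = Dint (\<tau> K) \<phi>"

definition eigenvalue_opH ::
  "nat \<Rightarrow> (nat \<Rightarrow> real) \<Rightarrow> (int \<Rightarrow> real^'m^'m) \<Rightarrow> complex \<Rightarrow> bool" where
  "eigenvalue_opH K \<tau> H z \<longleftrightarrow>
     (\<exists>\<phi> \<in> domH K \<tau> H. \<phi> \<noteq> (\<lambda>\<theta>\<in>{-\<tau> K..\<tau> K}. 0)
        \<and> opH K \<tau> \<phi> = (\<lambda>\<theta>\<in>{-\<tau> K..\<tau> K}. z *s \<phi> \<theta>))"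

definition domR0 ::
  "nat \<Rightarrow> (nat \<Rightarrow> real) \<Rightarrow> (int \<Rightarrow> real^'m^'m) \<Rightarrow> (real \<Rightarrow> complex^'m) set" where
  "domR0 K \<tau> H = {\<phi> \<in> CX1 (\<tau> K). Dint (\<tau> K) \<phi> \<in> CX1 (\<tau> K)
     \<and> Dint (\<tau> K) \<phi> 0 = bcond K \<tau> H \<phi>
     \<and> Dint (\<tau> K) (Dint (\<tau> K) \<phi>) 0 = bcond K \<tau> H (Dint (\<tau> K) \<phi>)}"

definition opR0 :: "nat \<Rightarrow> (nat \<Rightarrow> real) \<Rightarrow> (real \<Rightarrow> complex^'m) \<Rightarrow> real \<Rightarrow> complex^'m" where
  "opR0 K \<tau> \<phi> = Dint (\<tau> K) (Dint (\<tau> K) \<phi>)"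

lemma domR0_eq_square: "domR0 K \<tau> H = {\<phi> \<in> domH K \<tau> H. opH K \<tau> \<phi> \<in> domH K \<tau> H}"
  by (auto simp: domR0_def domH_def opH_def)

lemma opR0_eq_square: "opR0 K \<tau> \<phi> = opH K \<tau> (opH K \<tau> \<phi>)"
  by (simp add: opR0_def opH_def)


section \<open>Chebyshev expansions and the matrix \<open>Z\<^sub>N\<close>\<close>

definition cheb_sum :: "real \<Rightarrow> nat \<Rightarrow> (nat \<Rightarrow> real^'m) \<Rightarrow> real \<Rightarrow> complex^'m" where
  "cheb_sum r d c = (\<lambda>\<theta>\<in>{-r..r}. cvec (\<Sum>l=0..d. poly (cheb l) (\<theta> / r) *\<^sub>R c l))"

text \<open>Rows are \<open>l = 0, \<dots>, N\<close>, columns are \<open>j = 2, \<dots>, N + 2\<close>.\<close>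

definition ZN :: "nat \<Rightarrow> nat \<Rightarrow> nat \<Rightarrow> real" where
  "ZN N l j =
    (if N < l \<or> j < 2 \<or> N + 2 < j then 0
     else if l = 0 then (if j = 2 then 1/4 else 0)
     else if l = 1 then (if j = 3 then 1/24 else 0)
     else if l = 2 then (if j = 2 then - 1/6 else if j = 4 then 1/48 else 0)
     else if j = l + 2 then 1 / (4 * (real l + 1) * (real l + 2))
     else if j = l then - 1 / (2 * (real l - 1) * (real l + 1))
     else if 4 \<le> l \<and> j + 2 = l then 1 / (4 * (real l - 1) * (real l - 2))
     else 0)"

definition coeff_eqs ::
  "nat \<Rightarrow> (nat \<Rightarrow> real) \<Rightarrow> (int \<Rightarrow> real^'m^'m) \<Rightarrow> nat
     \<Rightarrow> (nat \<Rightarrow> real^'m) \<Rightarrow> (nat \<Rightarrow> real^'m) \<Rightarrow> bool" where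
  "coeff_eqs K \<tau> H N q v \<longleftrightarrow>
     (\<forall>j\<in>{2..N+2}. v j = (\<tau> K)\<^sup>2 *\<^sub>R (\<Sum>l=0..N. ZN N l j *\<^sub>R q l))
   \<and> charM K \<tau> H 0 *v cvec (v 1) =
       cvec (\<Sum>l=2..N+2.
         (poly (pderiv (cheb l)) 0 *\<^sub>R H 0
          + (\<Sum>k=1..K. poly (pderiv (cheb l)) (\<tau> k / \<tau> K) *\<^sub>R H (int k)
                   + poly (pderiv (cheb l)) (- \<tau> k / \<tau> K) *\<^sub>R H (- int k))
          - (poly (pderiv (pderiv (cheb l))) 0 / \<tau> K) *\<^sub>R mat 1) *v v l)
   \<and> charM K \<tau> H 0 *v cvec (v 0) =
       cvec (\<Sum>l=1..N+2.
         (poly (cheb l) 0 *\<^sub>R H 0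
          + (\<Sum>k=1..K. poly (cheb l) (\<tau> k / \<tau> K) *\<^sub>R H (int k)
                   + poly (cheb l) (- \<tau> k / \<tau> K) *\<^sub>R H (- int k))
          - (poly (pderiv (cheb l)) 0 / \<tau> K) *\<^sub>R mat 1) *v v l)"

end

theory Submission
  imports Defs
begin

text \<open>
  Inverting \<open>\<R>\<^sub>0 = \<H>\<^sup>2\<close> means integrating twice, each time fixing the integration constant by the
  nonlocal condition at \<open>0\<close>. Constants enter that condition only through \<open>M(0)\<close>: the boundary
  functional sends the constant function \<open>c\<close> to \<open>- M(0) c\<close> (\<open>bcond_const\<close>). A kernel vector of \<open>M(0)\<close>
  would therefore be a constant eigenfunction of \<open>\<H>\<close> for the eigenvalue \<open>0\<close>
  (\<open>invertible_charM_0\<close>); and once \<open>M(0)\<close> is invertible, every \<open>\<psi> \<in> X\<close> has exactly one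
  antiderivative in \<open>D(\<H>)\<close> (\<open>bij_betw_opH\<close>). Composing this bijection with itself gives the one
  for \<open>\<R>\<^sub>0\<close>.

  For a Chebyshev expansion the two integrations are explicit. The classical antiderivative formula
  \<open>T\<^sub>l = T\<^sub>l\<^sub>+\<^sub>1' / (2 (l + 1)) - T\<^sub>l\<^sub>-\<^sub>1' / (2 (l - 1))\<close>, applied twice, writes \<open>T\<^sub>l\<close> for \<open>l \<ge> 3\<close>
  (the smaller \<open>l\<close> are computed directly) as a combination of
  second derivatives \<open>T\<^sub>j''\<close>, and the coefficients are row \<open>l\<close> of \<open>Z\<^sub>N\<close>
  (\<open>sum_ZN_pderiv2_cheb\<close>); the factor \<open>\<tau>\<^sub>K\<^sup>2\<close> comes from the scaling \<open>\<theta> \<mapsto> \<theta> / \<tau>\<^sub>K\<close>. The affine part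
  \<open>v\<^sub>0 T\<^sub>0 + v\<^sub>1 T\<^sub>1\<close> of the solution \<open>u = \<R>\<^sub>0\<^sup>-\<^sup>1 \<phi>\<close> is invisible to \<open>u''\<close>. It is pinned down by
  the two conditions defining \<open>D(\<R>\<^sub>0)\<close>: evaluated on the expansion, the condition on \<open>u'\<close> is the linear system for \<open>v\<^sub>1\<close> and
  the condition on \<open>u\<close> is the one for \<open>v\<^sub>0\<close>. Hence a solution of the coefficient equations
  yields \<open>u\<close> (\<open>coeff_eqs_solves\<close>).

  Conversely, some solution exists because \<open>M(0)\<close> is real and invertible, and any expansion of
  \<open>u\<close> must agree with it, since Chebyshev polynomials are linearly independent
  (\<open>cheb_sum_inject\<close>).
\<close>

section \<open>Chebyshev polynomials\<close>

lemma cheb_0 [simp]: "cheb 0 = 1"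
  by (rule cheb_unique) (simp add: cheb_cos)

lemma cheb_1 [simp]: "cheb (Suc 0) = [:0, 1:]"
  by (rule cheb_unique) (simp add: cheb_cos)

lemma cheb_rec: "cheb (Suc (Suc l)) = [:0, 2:] * cheb (Suc l) - cheb l"
proof (rule cheb_unique)
  fix x :: real
  have a: "real (Suc (Suc l)) * x = real (Suc l) * x + x" and b: "real l * x = real (Suc l) * x - x"
    by (simp_all add: algebra_simps)
  show "poly (cheb (Suc (Suc l))) (cos x) = poly ([:0, 2:] * cheb (Suc l) - cheb l) (cos x)"
    unfolding poly_diff poly_mult cheb_cos a b cos_add cos_diff by (simp add: algebra_simps)
qed

text \<open>
  Positivity of the top coefficient records that the degree is exactly \<open>l\<close>, the input for linear
  independence.
\<close>

lemma degree_cheb_le_coeff_pos: "degree (cheb l) \<le> l \<and> 0 < coeff (cheb l) l"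
proof (induction l rule: less_induct)
  case (less l)
  consider "l = 0" | "l = 1" | m where "l = Suc (Suc m)"
    by (metis One_nat_def not0_implies_Suc)
  then show ?case
  proof cases
    case 3
    note ih1 = less.IH[of m] and ih2 = less.IH[of "Suc m"]
    have d: "degree (cheb m) \<le> m" "degree (cheb (Suc m)) \<le> Suc m" "0 < coeff (cheb (Suc m)) (Suc m)"
      using ih1 ih2 3 by auto
    have "degree ([:0, 2:] * cheb (Suc m)) \<le> Suc (Suc m)"
      using degree_mult_le[of "[:0, 2:]" "cheb (Suc m)"] d by simp
    then have "degree (cheb l) \<le> l"
      unfolding 3 cheb_rec using d by (intro degree_diff_le) auto
    moreover have "coeff (cheb l) l = 2 * coeff (cheb (Suc m)) (Suc m) - coeff (cheb m) (Suc (Suc m))"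
      unfolding 3 cheb_rec by simp
    moreover have "coeff (cheb m) (Suc (Suc m)) = 0"
      using d by (intro coeff_eq_0) simp
    ultimately show ?thesis using d by simp
  qed auto
qed

lemma cheb_lin_indep:
  assumes "(\<Sum>l=0..d. smult (a l) (cheb l)) = 0" "l \<le> d"
  shows "a l = 0"
  using assms
proof (induction d arbitrary: l)
  case 0
  then show ?case by simp
next
  case (Suc d)
  let ?n = "Suc d"
  have "coeff (\<Sum>l=0..?n. smult (a l) (cheb l)) ?n = a ?n * coeff (cheb ?n) ?n"
  proof -
    have "coeff (cheb k) ?n = 0" if "k \<le> d" for k
      using degree_cheb_le_coeff_pos[of k] that by (intro coeff_eq_0) simp
    then show ?thesis by (simp add: coeff_sum)
  qed
  with Suc.prems(1) degree_cheb_le_coeff_pos[of ?n] have an: "a ?n = 0" by simp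
  with Suc.prems(1) have "(\<Sum>l=0..d. smult (a l) (cheb l)) = 0" by simp
  with Suc.IH Suc.prems(2) an show ?case by (metis le_Suc_eq)
qed

text \<open>
  This is \<open>T\<^sub>l(cos x) = cos (l x)\<close> differentiated. The factor \<open>sin x\<close> vanishes at the multiples of
  \<open>\<pi>\<close>, so it is kept on the left instead of being divided out.
\<close>

lemma pderiv_cheb_cos: "poly (pderiv (cheb l)) (cos x) * sin x = real l * sin (real l * x)"
proof -
  have "((\<lambda>x. poly (cheb l) (cos x)) has_real_derivative
          poly (pderiv (cheb l)) (cos x) * (- sin x)) (at x)"
    by (rule DERIV_chain2[where g = cos]) (auto intro!: derivative_eq_intros poly_DERIV)
  moreover have "((\<lambda>x. poly (cheb l) (cos x)) has_real_derivative - sin (real l * x) * real l) (at x)"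
    unfolding cheb_cos by (auto intro!: derivative_eq_intros)
  ultimately have "poly (pderiv (cheb l)) (cos x) * (- sin x) = - sin (real l * x) * real l"
    by (rule DERIV_unique)
  then show ?thesis by simp
qed

text \<open>
  In terms of \<open>x\<close> this is \<open>sin ((l + 1) x) - sin ((l - 1) x) = 2 sin x cos (l x)\<close>. Both sides are
  first multiplied by \<open>1 - X\<^sup>2\<close>, which becomes \<open>sin\<^sup>2 x\<close> and supplies the factor \<open>sin x\<close> for the
  derivatives; it cancels in the polynomial ring.
\<close>

lemma cheb_eq_pderiv:
  assumes "2 \<le> l"
  shows "cheb l = smult (1 / (2 * (real l + 1))) (pderiv (cheb (l + 1)))
                - smult (1 / (2 * (real l - 1))) (pderiv (cheb (l - 1)))"
    (is "_ = ?p")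
proof -
  have "[:1, 0, -1:] * cheb l = [:1, 0, -1:] * ?p"
  proof (rule cheb_unique)
    fix x :: real
    have sq: "poly [:1, 0, -1:] (cos x) = sin x * sin x"
      using sin_cos_squared_add[of x] by (simp add: power2_eq_square)
    have a: "real (l + 1) * x = real l * x + x" and b: "real (l - 1) * x = real l * x - x"
      using assms by (simp_all add: algebra_simps of_nat_diff)
    have r: "real (l - 1) = real l - 1" "real l - 1 \<noteq> 0" using assms by (auto simp: of_nat_diff)
    have "poly ([:1, 0, -1:] * ?p) (cos x) = sin x *
       (1 / (2 * (real l + 1)) * (poly (pderiv (cheb (l + 1))) (cos x) * sin x)
      - 1 / (2 * (real l - 1)) * (poly (pderiv (cheb (l - 1))) (cos x) * sin x))"
      unfolding poly_mult sq by (simp add: algebra_simps)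
    also have "\<dots> = sin x * (sin (real l * x + x) / 2 - sin (real l * x - x) / 2)"
    proof -
      have "1 / (2 * (real l + 1)) * (real (l + 1) * y) = y / 2"
           "1 / (2 * (real l - 1)) * (real (l - 1) * y) = y / 2" for y
        using r by (simp_all add: divide_simps)
      then show ?thesis unfolding pderiv_cheb_cos a b by (simp only:)
    qed
    also have "sin (real l * x + x) / 2 - sin (real l * x - x) / 2 = sin x * cos (real l * x)"
      unfolding sin_add sin_diff by (simp add: field_simps)
    also have "sin x * (sin x * cos (real l * x)) = poly ([:1, 0, -1:] * cheb l) (cos x)"
      unfolding poly_mult sq cheb_cos by simp
    finally show "poly ([:1, 0, -1:] * cheb l) (cos x) = poly ([:1, 0, -1:] * ?p) (cos x)" ..
  qed
  then show ?thesis by (simp del: mult_pCons_left)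
qed

lemma cheb_2: "cheb 2 = [:-1, 0, 2:]"
  using cheb_rec[of 0] by (simp add: numeral_2_eq_2 one_pCons)

lemma cheb_3: "cheb 3 = [:0, -3, 0, 4:]"
  using cheb_rec[of 1] cheb_2 by (simp add: eval_nat_numeral)

lemma cheb_4: "cheb 4 = [:1, 0, -8, 0, 8:]"
  using cheb_rec[of 2] cheb_2 cheb_3 by (simp add: eval_nat_numeral)

text \<open>
  The antiderivative formula used twice. The two contributions to \<open>T\<^sub>l''\<close> combine because
  \<open>1 / (l + 1) + 1 / (l - 1) = 2 l / ((l - 1) (l + 1))\<close>. The index \<open>l - 1\<close> must be at least \<open>2\<close>, so
  \<open>l = 0, 1, 2\<close> have to be integrated by hand.
\<close>

lemma cheb_eq_pderiv2:
  assumes "3 \<le> l"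
  shows "poly (cheb l) x
     = 1 / (4 * (real l + 1) * (real l + 2)) * poly (pderiv (pderiv (cheb (l + 2)))) x
     - 1 / (2 * (real l - 1) * (real l + 1)) * poly (pderiv (pderiv (cheb l))) x
     + 1 / (4 * (real l - 1) * (real l - 2)) * poly (pderiv (pderiv (cheb (l - 2)))) x"
proof -
  let ?D = "\<lambda>l. poly (pderiv (cheb l)) x" and ?E = "\<lambda>l. poly (pderiv (pderiv (cheb l))) x"
  have 1: "poly (cheb l) x = 1 / (2 * (real l + 1)) * ?D (l + 1) - 1 / (2 * (real l - 1)) * ?D (l - 1)"
    using assms by (subst cheb_eq_pderiv) auto
  have 2: "?D (l + 1) = 1 / (2 * (real l + 2)) * ?E (l + 2) - 1 / (2 * real l) * ?E l"
    using assms by (subst cheb_eq_pderiv) (auto simp: pderiv_diff pderiv_smult add.commute)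
  have 3: "?D (l - 1) = 1 / (2 * real l) * ?E l - 1 / (2 * (real l - 2)) * ?E (l - 2)"
    using assms
    by (subst cheb_eq_pderiv) (auto simp: pderiv_diff pderiv_smult of_nat_diff numeral_2_eq_2)
  have "real l - 1 \<noteq> 0" "real l - 2 \<noteq> 0" "real l \<noteq> 0" "real l + 1 \<noteq> 0" "real l + 2 \<noteq> 0" using assms by auto
  then have c: "1 / (2 * (real l + 1)) * (1 / (2 * real l)) + 1 / (2 * (real l - 1)) * (1 / (2 * real l))
       = 1 / (2 * (real l - 1) * (real l + 1))"
    by (simp add: divide_simps) (simp add: algebra_simps)
  show ?thesis unfolding 1 2 3 c[symmetric] by (simp add: algebra_simps)
qed

text \<open>
  This is what \<open>Z\<^sub>N\<close> is made for: it performs double integration in the Chebyshev basis modulo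
  affine functions. For \<open>l = 3\<close> the general formula has a term in \<open>T\<^sub>1''\<close>, which is zero and
  accordingly has no entry in \<open>Z\<^sub>N\<close>.
\<close>

lemma sum_ZN_pderiv2_cheb:
  assumes "l \<le> N"
  shows "(\<Sum>j=2..N+2. ZN N l j * poly (pderiv (pderiv (cheb j))) x) = poly (cheb l) x"
proof -
  let ?E = "\<lambda>l. poly (pderiv (pderiv (cheb l))) x"
  have red: "(\<Sum>j=2..N+2. ZN N l j * ?E j) = (\<Sum>j\<in>S. ZN N l j * ?E j)"
    if "S \<subseteq> {2..N+2}" "\<And>j. j \<notin> S \<Longrightarrow> ZN N l j = 0" for S
    using that by (intro sum.mono_neutral_right) auto
  consider "l = 0" | "l = 1" | "l = 2" | "l = 3" | "4 \<le> l" by linarith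
  then show ?thesis
  proof cases
    case 1
    then show ?thesis by (subst red[of "{2}"]) (auto simp: ZN_def cheb_2 pderiv_pCons)
  next
    case 2
    then show ?thesis using assms
      by (subst red[of "{3}"]) (auto simp: ZN_def cheb_3 pderiv_pCons)
  next
    case 3
    then show ?thesis using assms
      by (subst red[of "{2, 4}"]) (auto simp: ZN_def cheb_2 cheb_4 pderiv_pCons algebra_simps)
  next
    case 4
    have "?E (l - 2) = 0" using 4 by (simp add: pderiv_pCons)
    then have "poly (cheb l) x = 1 / (4 * (real l + 1) * (real l + 2)) * ?E (l + 2)
        - 1 / (2 * (real l - 1) * (real l + 1)) * ?E l"
      using 4 by (subst cheb_eq_pderiv2) auto
    then show ?thesis using assms 4
      by (subst red[of "{l, l + 2}"]) (auto simp: ZN_def)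
  next
    case 5
    have "(\<Sum>j=2..N+2. ZN N l j * ?E j) = (\<Sum>j\<in>{l - 2, l, l + 2}. ZN N l j * ?E j)"
      using assms 5 by (intro red) (auto simp: ZN_def)
    also have "\<dots> = ZN N l (l - 2) * ?E (l - 2) + (ZN N l l * ?E l + ZN N l (l + 2) * ?E (l + 2))"
    proof -
      have "l - 2 \<notin> {l, l + 2}" "l \<notin> {l + 2}" using 5 by auto
      then show ?thesis by simp
    qed
    also have "\<dots> = poly (cheb l) x"
      using 5 assms cheb_eq_pderiv2[of l x] by (simp add: ZN_def)
    finally show ?thesis .
  qed
qed

section \<open>Complexification\<close>

lemma cvec_nth [simp]: "cvec x $ i = complex_of_real (x $ i)"
  by (simp add: cvec_def)

lemma bounded_linear_cvec: "bounded_linear cvec"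
  by (intro linear_conv_bounded_linear[THEN iffD1] linearI) (simp_all add: vec_eq_iff scaleR_conv_of_real[where 'a=complex])

lemmas cvec_sum = bounded_linear.linear[OF bounded_linear_cvec, THEN linear_sum]
lemmas cvec_add = bounded_linear.linear[OF bounded_linear_cvec, THEN linear_add]

lemma cvec_inject [simp]: "cvec x = cvec y \<longleftrightarrow> x = y"
  by (simp add: vec_eq_iff)

lemma cmat_mult_cvec: "cmat A *v cvec x = cvec (A *v x)"
  by (simp add: vec_eq_iff matrix_vector_mult_def map_matrix_def)

text \<open>
  The coefficient vectors have to be real although \<open>M(0)\<close> is invertible over the complex numbers:
  the real part of a complex solution of a real system is again a solution.
\<close>

lemma real_solution_if_invertible:
  fixes A :: "real^'m^'m"
  assumes "invertible (cmat A)"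
  shows "\<exists>x. A *v x = b"
proof -
  obtain B where B: "cmat A ** B = mat 1" using assms by (auto simp: invertible_def)
  define z where "z = B *v cvec b"
  have z: "cmat A *v z = cvec b" unfolding z_def
    by (simp add: matrix_vector_mul_assoc B)
  have "A *v (\<chi> i. Re (z $ i)) = b"
  proof (rule vec_eq_iff[THEN iffD2], rule allI)
    fix i
    have "Re ((cmat A *v z) $ i) = b $ i" unfolding z by simp
    then show "(A *v (\<chi> i. Re (z $ i))) $ i = b $ i"
      by (simp add: matrix_vector_mult_def map_matrix_def)
  qed
  then show ?thesis by blast
qed

section \<open>The nonlocal condition\<close>

text \<open>
  The matrix with \<open>bcond (p(\<cdot> / \<tau>\<^sub>K) c) = delay_mat p c\<close>, that is, the boundary functional on
  multiples of the scaled polynomial \<open>p\<close>.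
\<close>

definition delay_mat :: "nat \<Rightarrow> (nat \<Rightarrow> real) \<Rightarrow> (int \<Rightarrow> real^'m^'m) \<Rightarrow> real poly \<Rightarrow> real^'m^'m" where
  "delay_mat K \<tau> H p = poly p 0 *\<^sub>R H 0
     + (\<Sum>k=1..K. poly p (\<tau> k / \<tau> K) *\<^sub>R H (int k) + poly p (- \<tau> k / \<tau> K) *\<^sub>R H (- int k))"

lemma cmat_add: "cmat (A + B) = cmat A + cmat B"
  and cmat_uminus: "cmat (- A) = - cmat A"
  and cmat_sum: "cmat (\<Sum>k\<in>S. F k) = (\<Sum>k\<in>S. cmat (F k))"
proof -
  show add: "cmat (A + B) = cmat A + cmat B" for A B :: "real^'m^'m"
    by (simp add: vec_eq_iff map_matrix_def)
  show "cmat (- A) = - cmat A" by (simp add: vec_eq_iff map_matrix_def)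
  show "cmat (\<Sum>k\<in>S. F k) = (\<Sum>k\<in>S. cmat (F k))"
    by (induction S rule: infinite_finite_induct) (auto simp: add, auto simp: vec_eq_iff map_matrix_def)
qed

lemma map_matrix_mult_1: "map_matrix ((*) 1) (A :: complex^'m^'m) = A"
  by (simp add: vec_eq_iff map_matrix_def)

lemma uminus_matrix_vector_mult: "(- A) *v x = - (A *v x)" for A :: "'a::ring_1^'n^'m"
  by (simp add: vec_eq_iff matrix_vector_mult_def sum_negf)

text \<open>
  At \<open>\<lambda> = 0\<close> all exponentials are \<open>1\<close>, so \<open>M(0)\<close> is a real matrix, and it is the boundary
  functional on constants up to sign.
\<close>

lemma charM_0: "charM K \<tau> H 0 = cmat (- delay_mat K \<tau> H 1)"
proof -
  have "charM K \<tau> H 0 = - (cmat (H 0) + (\<Sum>k=1..K. cmat (H (- int k)) + cmat (H (int k))))"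
    by (simp add: charM_def mat_0 map_matrix_mult_1)
  also have "\<dots> = cmat (- delay_mat K \<tau> H 1)"
    unfolding cmat_uminus by (simp add: delay_mat_def cmat_add cmat_sum add.commute)
  finally show ?thesis .
qed

text \<open>
  The functional sees its argument only at \<open>0\<close> and \<open>\<plusminus> \<tau>\<^sub>k\<close>. Elements of \<open>X\<close> are undefined outside
  the interval, so the decomposition can be required at these points only.
\<close>

lemma bcond_add: 
  assumes "\<And>\<theta>. \<theta> \<in> insert 0 (\<tau> ` {1..K} \<union> (\<lambda>k. - \<tau> k) ` {1..K}) \<Longrightarrow> \<eta> \<theta> = \<phi> \<theta> + \<psi> \<theta>"
  shows "bcond K \<tau> H \<eta> = bcond K \<tau> H \<phi> + bcond K \<tau> H \<psi>"
proof -
  have "\<And>k. k \<in> {1..K} \<Longrightarrow> \<eta> (\<tau> k) = \<phi> (\<tau> k) + \<psi> (\<tau> k)"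
       "\<And>k. k \<in> {1..K} \<Longrightarrow> \<eta> (- \<tau> k) = \<phi> (- \<tau> k) + \<psi> (- \<tau> k)" "\<eta> 0 = \<phi> 0 + \<psi> 0"
    using assms by blast+
  then show ?thesis
    unfolding bcond_def by (simp add: matrix_vector_right_distrib sum.distrib algebra_simps)
qed

lemma sum_matrix_vector_mult: "(\<Sum>k\<in>S. F k) *v x = (\<Sum>k\<in>S. F k *v x)"
  by (induction S rule: infinite_finite_induct) (auto simp: matrix_vector_mult_add_rdistrib)

lemma bcond_const: 
  assumes "\<And>\<theta>. \<theta> \<in> insert 0 (\<tau> ` {1..K} \<union> (\<lambda>k. - \<tau> k) ` {1..K}) \<Longrightarrow> \<phi> \<theta> = c"
  shows "bcond K \<tau> H \<phi> = - (charM K \<tau> H 0 *v c)"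
proof -
  have "\<And>k. k \<in> {1..K} \<Longrightarrow> \<phi> (\<tau> k) = c" "\<And>k. k \<in> {1..K} \<Longrightarrow> \<phi> (- \<tau> k) = c" "\<phi> 0 = c"
    using assms by blast+
  then have "bcond K \<tau> H \<phi> = cmat (delay_mat K \<tau> H 1) *v c"
    unfolding bcond_def delay_mat_def
    by (simp add: cmat_add cmat_sum matrix_vector_mult_add_rdistrib sum_matrix_vector_mult add.commute)
  then show ?thesis by (simp add: charM_0 cmat_uminus uminus_matrix_vector_mult)
qed

section \<open>Inverting the derivative\<close>

lemma CX1_I:
  assumes "0 < r" "\<phi> \<in> extensional {-r..r}" "\<psi> \<in> CX r"
    and "\<And>\<theta>. \<theta> \<in> {-r..r} \<Longrightarrow> (\<phi> has_vector_derivative \<psi> \<theta>) (at \<theta> within {-r..r})"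
  shows "\<phi> \<in> CX1 r" "Dint r \<phi> = \<psi>"
proof -
  have "vector_derivative \<phi> (at \<theta> within {-r..r}) = \<psi> \<theta>" if "\<theta> \<in> {-r..r}" for \<theta>
    using vector_derivative_within_cbox[of "-r" r \<theta> \<phi> "\<psi> \<theta>"] assms(4)[OF that] that assms(1) by simp
  moreover have "\<psi> \<in> extensional {-r..r}" using assms(3) by (simp add: CX_def)
  ultimately show D: "Dint r \<phi> = \<psi>"
    by (intro ext) (auto simp: Dint_def restrict_def extensional_def)
  have "continuous_on {-r..r} \<phi>"
    using assms(4) by (meson continuous_on_vector_derivative)
  moreover have "\<forall>\<theta>\<in>{-r..r}. \<phi> differentiable (at \<theta> within {-r..r})"
    using assms(4) by (meson differentiableI_vector)
  ultimately show "\<phi> \<in> CX1 r" using assms(2,3) D by (simp add: CX1_def CX_def)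
qed

lemma CX1_derivative:
  assumes "\<phi> \<in> CX1 r" "\<theta> \<in> {-r..r}"
  shows "(\<phi> has_vector_derivative Dint r \<phi> \<theta>) (at \<theta> within {-r..r})"
  using assms by (simp add: CX1_def Dint_def vector_derivative_works)

lemma antiderivative_exists:
  fixes \<psi> :: "real \<Rightarrow> complex^'m"
  assumes "0 < r" "\<psi> \<in> CX r"
  shows "\<exists>\<phi>. \<forall>\<theta>\<in>{-r..r}. (\<phi> has_vector_derivative \<psi> \<theta>) (at \<theta> within {-r..r})"
proof -
  have "continuous_on {-r..r} \<psi>" using assms by (simp add: CX_def)
  then show ?thesis using integral_has_vector_derivative by blast
qed

locale delays =
  fixes K :: nat and \<tau> :: "nat \<Rightarrow> real" and H :: "int \<Rightarrow> real^'m^'m"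
  assumes K_pos: "1 \<le> K" and tau_pos: "0 < \<tau> 1" and tau_mono: "strict_mono_on {1..K} \<tau>"
begin

lemma tau_bounds: 
  assumes "k \<in> {1..K}" 
  shows "0 < \<tau> k" "\<tau> k \<le> \<tau> K"
proof -
  have m: "mono_on {1..K} \<tau>" using tau_mono by (rule strict_mono_on_imp_mono_on)
  have "\<tau> 1 \<le> \<tau> k" using assms K_pos by (intro mono_onD[OF m]) auto
  then show "0 < \<tau> k" using tau_pos by simp
  show "\<tau> k \<le> \<tau> K" using assms K_pos by (intro mono_onD[OF m]) auto
qed

lemma horizon_pos: "0 < \<tau> K"
  using tau_bounds[of K] K_pos by simp

lemma nodes_in_interval:
  "\<theta> \<in> insert 0 (\<tau> ` {1..K} \<union> (\<lambda>k. - \<tau> k) ` {1..K}) \<Longrightarrow> \<theta> \<in> {-\<tau> K..\<tau> K}"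
  using tau_bounds horizon_pos by fastforce

text \<open>
  A kernel vector of \<open>M(0)\<close>, taken as a constant function, satisfies the boundary condition and
  has derivative \<open>0\<close>.
\<close>

lemma invertible_charM_0:
  assumes "\<not> eigenvalue_opH K \<tau> H 0"
  shows "invertible (charM K \<tau> H 0)"
proof (rule ccontr)
  assume "\<not> invertible (charM K \<tau> H 0)"
  then obtain c where c: "c \<noteq> 0" "charM K \<tau> H 0 *v c = 0"
    using matrix_left_invertible_ker[of "charM K \<tau> H 0"] invertible_left_inverse by blast
  let ?I = "{-\<tau> K..\<tau> K}"
  let ?c = "\<lambda>\<theta>\<in>?I. c" and ?z = "(\<lambda>\<theta>\<in>?I. 0) :: real \<Rightarrow> complex^'m"
  have der: "(?c has_vector_derivative ?z \<theta>) (at \<theta> within ?I)" if "\<theta> \<in> ?I" for \<theta>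
    by (rule has_vector_derivative_transform[where f = "\<lambda>_. c"]) (use that in auto)
  have z: "?z \<in> CX (\<tau> K)" by (simp add: CX_def cong: continuous_on_cong_simp)
  have 1: "?c \<in> CX1 (\<tau> K)" and 2: "Dint (\<tau> K) ?c = ?z"
    using CX1_I[OF horizon_pos _ z der] by auto
  have "bcond K \<tau> H ?c = - (charM K \<tau> H 0 *v c)"
    by (rule bcond_const) (use nodes_in_interval in simp)
  then have "?c \<in> domH K \<tau> H" using 1 2 c(2) horizon_pos by (simp add: domH_def)
  moreover have "?c \<noteq> ?z" using c(1) horizon_pos by (auto dest!: fun_cong[of _ _ 0])
  moreover have "opH K \<tau> ?c = (\<lambda>\<theta>\<in>?I. 0 *s ?c \<theta>)"
    using 2 by (simp add: opH_def)
  ultimately show False using assms unfolding eigenvalue_opH_def by blast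
qed

text \<open>
  Two antiderivatives differ by a constant \<open>c\<close>, which changes the boundary functional by
  \<open>- M(0) c\<close>; so exactly one of them lies in \<open>D(\<H>)\<close>.
\<close>

lemma bij_betw_opH:
  assumes "invertible (charM K \<tau> H 0)"
  shows "bij_betw (opH K \<tau>) (domH K \<tau> H) (CX (\<tau> K))"
  unfolding bij_betw_def
proof (intro conjI inj_onI subset_antisym subsetI)
  let ?I = "{-\<tau> K..\<tau> K}" and ?M = "charM K \<tau> H 0"
  obtain B where B: "?M ** B = mat 1" "B ** ?M = mat 1"
    using assms by (auto simp: invertible_def)
  {
    fix \<phi> \<psi> assume \<phi>: "\<phi> \<in> domH K \<tau> H" and \<psi>: "\<psi> \<in> domH K \<tau> H" and eq: "opH K \<tau> \<phi> = opH K \<tau> \<psi>"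
    have "((\<lambda>\<theta>. \<phi> \<theta> - \<psi> \<theta>) has_vector_derivative 0) (at \<theta> within ?I)" if "\<theta> \<in> ?I" for \<theta>
      using has_vector_derivative_diff[OF CX1_derivative CX1_derivative, of \<phi> "\<tau> K" \<theta> \<psi>] that \<phi> \<psi> eq
      by (simp add: domH_def opH_def)
    then obtain c where c: "\<And>\<theta>. \<theta> \<in> ?I \<Longrightarrow> \<phi> \<theta> - \<psi> \<theta> = c"
      using has_vector_derivative_zero_constant[of ?I "\<lambda>\<theta>. \<phi> \<theta> - \<psi> \<theta>"] by auto
    have "bcond K \<tau> H \<phi> = bcond K \<tau> H \<psi> + bcond K \<tau> H (\<lambda>_. c)"
      by (rule bcond_add) (use c nodes_in_interval in \<open>simp add: algebra_simps\<close>)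
    then have "?M *v c = 0"
      using \<phi> \<psi> eq by (simp add: domH_def opH_def bcond_const)
    then have "B ** ?M *v c = 0" by (simp flip: matrix_vector_mul_assoc)
    then have "c = 0" by (simp add: B)
    moreover have "\<phi> \<in> extensional ?I" "\<psi> \<in> extensional ?I"
      using \<phi> \<psi> by (auto simp: domH_def CX1_def CX_def)
    ultimately show "\<phi> = \<psi>" using c by (intro extensionalityI[of _ ?I]) auto
  }
  show "\<psi> \<in> CX (\<tau> K)" if "\<psi> \<in> opH K \<tau> ` domH K \<tau> H" for \<psi>
    using that by (auto simp: domH_def opH_def CX1_def)
  fix \<psi> :: "real \<Rightarrow> complex^'m" assume \<psi>: "\<psi> \<in> CX (\<tau> K)"
  obtain \<Psi> where \<Psi>: "\<forall>\<theta>\<in>?I. (\<Psi> has_vector_derivative \<psi> \<theta>) (at \<theta> within ?I)"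
    using antiderivative_exists[OF horizon_pos \<psi>] by blast
  \<comment> \<open>The constant for which \<open>\<psi> 0 = bcond (\<Psi> + c) = bcond \<Psi> - M(0) c\<close>.\<close>
  define c where "c = B *v (bcond K \<tau> H \<Psi> - \<psi> 0)"
  have c: "?M *v c = bcond K \<tau> H \<Psi> - \<psi> 0"
    by (simp add: c_def matrix_vector_mul_assoc B)
  define \<phi> where "\<phi> = (\<lambda>\<theta>\<in>?I. \<Psi> \<theta> + c)"
  have der: "(\<phi> has_vector_derivative \<psi> \<theta>) (at \<theta> within ?I)" if "\<theta> \<in> ?I" for \<theta>
    by (rule has_vector_derivative_transform[where f = "\<lambda>\<theta>. \<Psi> \<theta> + c"])
      (use that \<Psi> in \<open>auto simp: \<phi>_def has_vector_derivative_add_const\<close>)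
  have 1: "\<phi> \<in> CX1 (\<tau> K)" and 2: "Dint (\<tau> K) \<phi> = \<psi>"
    using CX1_I[OF horizon_pos _ \<psi> der] by (auto simp: \<phi>_def)
  have "bcond K \<tau> H \<phi> = bcond K \<tau> H \<Psi> + bcond K \<tau> H (\<lambda>_. c)"
    by (rule bcond_add) (use nodes_in_interval in \<open>simp add: \<phi>_def\<close>)
  then have "\<phi> \<in> domH K \<tau> H" using 1 2 c by (simp add: domH_def bcond_const)
  then show "\<psi> \<in> opH K \<tau> ` domH K \<tau> H" using 2 by (force simp: opH_def)
qed

text \<open>
  \<open>D(\<R>\<^sub>0)\<close> is the preimage of \<open>D(\<H>) \<subseteq> X\<close> under \<open>\<H>\<close>, hence \<open>\<H>\<close> maps it bijectively onto \<open>D(\<H>)\<close>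
  and a second application leads onto \<open>X\<close>.
\<close>

lemma bij_betw_opR0:
  assumes "invertible (charM K \<tau> H 0)"
  shows "bij_betw (opR0 K \<tau>) (domR0 K \<tau> H) (CX (\<tau> K))"
proof -
  note b = bij_betw_opH[OF assms]
  have "domH K \<tau> H \<subseteq> CX (\<tau> K)" by (auto simp: domH_def CX1_def)
  then have "opH K \<tau> ` domR0 K \<tau> H = domH K \<tau> H"
    using b by (force simp: domR0_eq_square bij_betw_def)
  then have "bij_betw (opH K \<tau>) (domR0 K \<tau> H) (domH K \<tau> H)"
    using b by (intro bij_betw_subset[OF b]) (auto simp: domR0_eq_square)
  from bij_betw_trans[OF this b] show ?thesis
    by (simp add: comp_def opR0_eq_square[abs_def])
qed

end

section \<open>Polynomial expansions\<close>

text \<open>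
  Allowing an arbitrary family \<open>p\<close> of polynomials closes the Chebyshev expansions under
  differentiation without re-expanding \<open>T\<^sub>l'\<close> in the Chebyshev basis.
\<close>

definition poly_sum :: "real \<Rightarrow> nat \<Rightarrow> (nat \<Rightarrow> real poly) \<Rightarrow> (nat \<Rightarrow> real^'m) \<Rightarrow> real \<Rightarrow> complex^'m" where
  "poly_sum r d p c = (\<lambda>\<theta>\<in>{-r..r}. cvec (\<Sum>l=0..d. poly (p l) (\<theta> / r) *\<^sub>R c l))"

lemma cheb_sum_eq_poly_sum: "cheb_sum r d c = poly_sum r d cheb c"
  by (simp add: cheb_sum_def poly_sum_def)

lemma poly_sum_CX: "poly_sum r d p c \<in> CX r"
proof -
  have "continuous_on {-r..r} (\<lambda>\<theta>. cvec (\<Sum>l=0..d. poly (p l) (\<theta> / r) *\<^sub>R c l))"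
    by (cases "r = 0") (auto simp: divide_inverse intro!: continuous_intros bounded_linear.continuous_on[OF bounded_linear_cvec])
  then show ?thesis by (simp add: CX_def poly_sum_def cong: continuous_on_cong_simp)
qed

lemma poly_sum_CX1:
  assumes "0 < r"
  shows "poly_sum r d p c \<in> CX1 r"
    and "Dint r (poly_sum r d p c) = poly_sum r d (\<lambda>l. pderiv (p l)) (\<lambda>l. c l /\<^sub>R r)"
proof -
  let ?I = "{-r..r}"
  have der: "(poly_sum r d p c has_vector_derivative
         poly_sum r d (\<lambda>l. pderiv (p l)) (\<lambda>l. c l /\<^sub>R r) \<theta>) (at \<theta> within ?I)" if "\<theta> \<in> ?I" for \<theta>
  proof (rule has_vector_derivative_transform[where f = "\<lambda>\<theta>. cvec (\<Sum>l=0..d. poly (p l) (\<theta> / r) *\<^sub>R c l)"])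
    have "((\<lambda>\<theta>. poly (p l) (\<theta> / r)) has_real_derivative poly (pderiv (p l)) (\<theta> / r) * (1 / r)) (at \<theta> within ?I)" for l
      by (rule DERIV_chain2[OF poly_DERIV]) (use assms in \<open>auto intro!: derivative_eq_intros\<close>)
    from has_vector_derivative_scaleR[OF this has_vector_derivative_const]
    have "((\<lambda>\<theta>. poly (p l) (\<theta> / r) *\<^sub>R c l) has_vector_derivative
           poly (pderiv (p l)) (\<theta> / r) *\<^sub>R (c l /\<^sub>R r)) (at \<theta> within ?I)" for l
      by (simp add: divide_inverse)
    then have "((\<lambda>\<theta>. \<Sum>l=0..d. poly (p l) (\<theta> / r) *\<^sub>R c l) has_vector_derivative
           (\<Sum>l=0..d. poly (pderiv (p l)) (\<theta> / r) *\<^sub>R (c l /\<^sub>R r))) (at \<theta> within ?I)"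
      by (intro has_vector_derivative_sum)
    from bounded_linear.has_vector_derivative[OF bounded_linear_cvec this]
    show "((\<lambda>\<theta>. cvec (\<Sum>l=0..d. poly (p l) (\<theta> / r) *\<^sub>R c l)) has_vector_derivative
        poly_sum r d (\<lambda>l. pderiv (p l)) (\<lambda>l. c l /\<^sub>R r) \<theta>) (at \<theta> within ?I)"
      using that by (simp add: poly_sum_def)
  qed (use that in \<open>auto simp: poly_sum_def\<close>)
  show "poly_sum r d p c \<in> CX1 r"
    and "Dint r (poly_sum r d p c) = poly_sum r d (\<lambda>l. pderiv (p l)) (\<lambda>l. c l /\<^sub>R r)"
    using CX1_I[OF assms _ poly_sum_CX der] by (auto simp: poly_sum_def)
qed

text \<open>
  As \<open>\<theta> = r cos x\<close> runs through the interval, equality of the functions becomes, in each component,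
  a polynomial identity at all \<open>cos x\<close>, and linear independence applies.
\<close>

lemma cheb_sum_inject:
  assumes "0 < r" "cheb_sum r d v = cheb_sum r d w" "l \<le> d"
  shows "v l = w l"
proof (rule vec_eq_iff[THEN iffD2], rule allI)
  fix i
  let ?p = "\<Sum>l=0..d. smult (v l $ i - w l $ i) (cheb l)"
  have "?p = 0"
  proof (rule cheb_unique)
    fix x :: real
    have "r * cos x \<in> {-r..r}"
      using assms(1) cos_le_one[of x] cos_ge_minus_one[of x] mult_left_mono[of _ _ r]
      by (metis atLeastAtMost_iff less_imp_le mult.right_neutral mult_minus_right)
    then have "(\<Sum>l=0..d. poly (cheb l) (cos x) *\<^sub>R v l) = (\<Sum>l=0..d. poly (cheb l) (cos x) *\<^sub>R w l)"
      using fun_cong[OF assms(2), of "r * cos x"] assms(1) by (simp add: cheb_sum_def)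
    then have "(\<Sum>l=0..d. poly (cheb l) (cos x) *\<^sub>R v l) $ i = (\<Sum>l=0..d. poly (cheb l) (cos x) *\<^sub>R w l) $ i"
      by simp
    then show "poly ?p (cos x) = poly 0 (cos x)"
      by (simp add: poly_sum algebra_simps sum_subtractf)
  qed
  from cheb_lin_indep[OF this assms(3)] show "v l $ i = w l $ i" by simp
qed

context delays
begin

lemma bcond_poly_sum:
  "bcond K \<tau> H (poly_sum (\<tau> K) d p c) = cvec (\<Sum>l=0..d. delay_mat K \<tau> H (p l) *v c l)"
proof -
  let ?f = "\<lambda>\<theta>. \<Sum>l=0..d. poly (p l) (\<theta> / \<tau> K) *\<^sub>R c l"
  have e: "poly_sum (\<tau> K) d p c \<theta> = cvec (?f \<theta>)"
    if "\<theta> \<in> insert 0 (\<tau> ` {1..K} \<union> (\<lambda>k. - \<tau> k) ` {1..K})" for \<theta>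
    using nodes_in_interval[OF that] by (simp add: poly_sum_def)
  have "bcond K \<tau> H (poly_sum (\<tau> K) d p c) = bcond K \<tau> H (\<lambda>\<theta>. cvec (?f \<theta>))"
    unfolding bcond_def using e by simp
  also have "\<dots> = cvec (H 0 *v ?f 0 + (\<Sum>k=1..K. H (int k) *v ?f (\<tau> k) + H (- int k) *v ?f (- \<tau> k)))"
    unfolding bcond_def cmat_mult_cvec cvec_add cvec_sum[of _ "{1..K}"] by (simp add: add.commute)
  also have "H 0 *v ?f 0 + (\<Sum>k=1..K. H (int k) *v ?f (\<tau> k) + H (- int k) *v ?f (- \<tau> k))
      = (\<Sum>l=0..d. delay_mat K \<tau> H (p l) *v c l)"
  proof -
    have A: "A *v ?f \<theta> = (\<Sum>l=0..d. poly (p l) (\<theta> / \<tau> K) *\<^sub>R (A *v c l))" for A \<theta>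
      by (simp add: matrix_vector_mult_scaleR linear_sum[OF matrix_vector_mul_linear])
    show ?thesis
      unfolding A delay_mat_def
      by (simp add: matrix_vector_mult_add_rdistrib sum_matrix_vector_mult scaleR_matrix_vector_assoc[symmetric]
          sum.distrib scaleR_sum_right)
        (simp only: sum.swap[of _ "{0..d}"])
  qed
  finally show ?thesis .
qed

text \<open>
  For \<open>u = p(\<cdot> / \<tau>\<^sub>K) c\<close> the difference \<open>bcond u - u'(0)\<close> is \<open>defect p c\<close>. These are also the
  matrices on the right-hand sides of the equations for \<open>v\<^sub>1\<close> (with \<open>p = T\<^sub>l'\<close>) and \<open>v\<^sub>0\<close> (with
  \<open>p = T\<^sub>l\<close>).
\<close>

definition defect :: "real poly \<Rightarrow> real^'m^'m" where
  "defect p = delay_mat K \<tau> H p - (poly (pderiv p) 0 / \<tau> K) *\<^sub>R mat 1"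

lemma Dint_poly_sum_eq_bcond_iff:
  "Dint (\<tau> K) (poly_sum (\<tau> K) d p c) 0 = bcond K \<tau> H (poly_sum (\<tau> K) d p c)
     \<longleftrightarrow> (\<Sum>l=0..d. defect (p l) *v c l) = 0"
proof -
  have "Dint (\<tau> K) (poly_sum (\<tau> K) d p c) 0 = cvec (\<Sum>l=0..d. (poly (pderiv (p l)) 0 / \<tau> K) *\<^sub>R c l)"
    using horizon_pos by (simp add: poly_sum_CX1) (simp add: poly_sum_def divide_inverse)
  moreover have "(\<Sum>l=0..d. defect (p l) *v c l)
     = (\<Sum>l=0..d. delay_mat K \<tau> H (p l) *v c l) - (\<Sum>l=0..d. (poly (pderiv (p l)) 0 / \<tau> K) *\<^sub>R c l)"
    by (simp add: defect_def matrix_vector_mult_diff_rdistrib scaleR_matrix_vector_assoc[symmetric] sum_subtractf)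
  ultimately show ?thesis by (auto simp: bcond_poly_sum)
qed

lemma defect_1: "defect 1 = delay_mat K \<tau> H 1"
  by (simp add: defect_def)

lemma defect_0: "defect 0 = 0"
  by (simp add: defect_def delay_mat_def)

lemma charM_0_mult_cvec_eq_iff:
  "charM K \<tau> H 0 *v cvec x = cvec y \<longleftrightarrow> defect 1 *v x + y = 0"
  unfolding charM_0 cmat_mult_cvec defect_1 cvec_inject uminus_matrix_vector_mult
  by (metis add_eq_0_iff)

text \<open>
  Since \<open>M(0) = - defect 1\<close> and \<open>T\<^sub>0 = T\<^sub>1' = 1\<close>, moving the left-hand sides over turns the equations
  for \<open>v\<^sub>1\<close> and \<open>v\<^sub>0\<close> into the vanishing of the total defect of the expansions of \<open>u'\<close> and \<open>u = \<Sum>\<^sub>l v\<^sub>l T\<^sub>l(\<cdot> / \<tau>\<^sub>K)\<close>.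
\<close>

lemma coeff_eqs_iff:
  "coeff_eqs K \<tau> H N q v \<longleftrightarrow>
     (\<forall>j\<in>{2..N+2}. v j = (\<tau> K)\<^sup>2 *\<^sub>R (\<Sum>l=0..N. ZN N l j *\<^sub>R q l))
   \<and> defect 1 *v v 1 + (\<Sum>l=2..N+2. defect (pderiv (cheb l)) *v v l) = 0
   \<and> defect 1 *v v 0 + (\<Sum>l=1..N+2. defect (cheb l) *v v l) = 0"
  unfolding coeff_eqs_def charM_0_mult_cvec_eq_iff by (simp only: defect_def delay_mat_def)

text \<open>
  The system is triangular: \<open>v\<^sub>2, \<dots>\<close> are explicit, they determine \<open>v\<^sub>1\<close>, and then \<open>v\<^sub>0\<close>.
\<close>

lemma coeff_eqs_exists:
  assumes "invertible (charM K \<tau> H 0)"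
  shows "\<exists>v. coeff_eqs K \<tau> H N q v"
proof -
  have solve: "\<exists>x. defect 1 *v x + y = 0" for y
    using real_solution_if_invertible[OF assms[unfolded charM_0], of y]
    by (metis charM_0 charM_0_mult_cvec_eq_iff cmat_mult_cvec)
  let ?w = "\<lambda>j. (\<tau> K)\<^sup>2 *\<^sub>R (\<Sum>l=0..N. ZN N l j *\<^sub>R q l)"
  obtain a where a: "defect 1 *v a + (\<Sum>l=2..N+2. defect (pderiv (cheb l)) *v ?w l) = 0"
    using solve by blast
  let ?u = "?w(1 := a)"
  obtain b where b: "defect 1 *v b + (\<Sum>l=1..N+2. defect (cheb l) *v ?u l) = 0"
    using solve by blast
  have "coeff_eqs K \<tau> H N q (?u(0 := b))"
    unfolding coeff_eqs_iff using a b by simp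
  then show ?thesis by blast
qed

lemma coeff_eqs_cong:
  assumes "coeff_eqs K \<tau> H N q v" "\<And>l. l \<le> N + 2 \<Longrightarrow> v l = w l"
  shows "coeff_eqs K \<tau> H N q w"
proof -
  have sums: "(\<Sum>l=a..N+2. F l *v w l) = (\<Sum>l=a..N+2. F l *v v l)" for a and F :: "nat \<Rightarrow> real^'m^'m"
    using assms(2) by (intro sum.cong) auto
  have w: "w 0 = v 0" "w 1 = v 1" using assms(2) by auto
  have "\<forall>j\<in>{2..N+2}. w j = (\<tau> K)\<^sup>2 *\<^sub>R (\<Sum>l=0..N. ZN N l j *\<^sub>R q l)"
    using assms unfolding coeff_eqs_iff by auto
  then show ?thesis
    using assms(1) unfolding coeff_eqs_iff sums w by blast
qed

lemma coeff_eqs_solves: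
  assumes "coeff_eqs K \<tau> H N q v"
  shows "cheb_sum (\<tau> K) (N + 2) v \<in> domR0 K \<tau> H"
    and "opR0 K \<tau> (cheb_sum (\<tau> K) (N + 2) v) = cheb_sum (\<tau> K) N q"
proof -
  let ?r = "\<tau> K" and ?d = "N + 2"
  let ?\<phi> = "poly_sum ?r ?d cheb v"
  have v: "v j = ?r\<^sup>2 *\<^sub>R (\<Sum>l=0..N. ZN N l j *\<^sub>R q l)" if "j \<in> {2..?d}" for j
    using assms that unfolding coeff_eqs_iff by blast
  have D1: "Dint ?r ?\<phi> = poly_sum ?r ?d (\<lambda>l. pderiv (cheb l)) (\<lambda>l. v l /\<^sub>R ?r)"
    using horizon_pos by (rule poly_sum_CX1)
  have D2: "Dint ?r (Dint ?r ?\<phi>) = poly_sum ?r ?d (\<lambda>l. pderiv (pderiv (cheb l))) (\<lambda>l. v l /\<^sub>R ?r /\<^sub>R ?r)"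
    unfolding D1 using horizon_pos by (rule poly_sum_CX1)
  have split0: "(\<Sum>l=0..?d. f l) = f 0 + (\<Sum>l=1..?d. f l)" for f :: "nat \<Rightarrow> real^'m"
    by (simp add: sum.atLeast_Suc_atMost)
  have split1: "(\<Sum>l=1..?d. f l) = f 1 + (\<Sum>l=2..?d. f l)" for f :: "nat \<Rightarrow> real^'m"
    by (simp add: sum.atLeast_Suc_atMost numeral_2_eq_2)
  have c0: "Dint ?r ?\<phi> 0 = bcond K \<tau> H ?\<phi>"
    unfolding Dint_poly_sum_eq_bcond_iff split0 using assms by (simp add: coeff_eqs_iff del: sum.cl_ivl_Suc)
  \<comment> \<open>The terms for \<open>T\<^sub>0' = 0\<close> and \<open>T\<^sub>1' = 1\<close> are split off; the common factor \<open>1 / \<tau>\<^sub>K\<close> of the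
    coefficients of \<open>\<phi>'\<close> drops out of the homogeneous condition.\<close>
  have "(\<Sum>l=0..?d. defect (pderiv (cheb l)) *v (v l /\<^sub>R ?r))
      = (\<Sum>l=0..?d. defect (pderiv (cheb l)) *v v l) /\<^sub>R ?r"
    by (simp add: matrix_vector_mult_scaleR scaleR_sum_right del: sum.cl_ivl_Suc)
  also have "\<dots> = 0"
  proof -
    have "pderiv (cheb 0) = 0" "pderiv (cheb 1) = 1" by (simp_all add: pderiv_pCons one_pCons)
    moreover have "defect 1 *v v 1 + (\<Sum>l=2..?d. defect (pderiv (cheb l)) *v v l) = 0"
      using assms unfolding coeff_eqs_iff by blast
    ultimately show ?thesis
      unfolding split0 split1 by (simp only: defect_0 matrix_vector_mult_0 add_0 scaleR_zero_right)
  qed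
  finally have c1: "Dint ?r (Dint ?r ?\<phi>) 0 = bcond K \<tau> H (Dint ?r ?\<phi>)"
    unfolding D1 Dint_poly_sum_eq_bcond_iff .
  show "cheb_sum ?r ?d v \<in> domR0 K \<tau> H"
    unfolding cheb_sum_eq_poly_sum domR0_def
    using c0 c1 D1 by (simp add: poly_sum_CX1(1)[OF horizon_pos])
  have "(\<Sum>j=0..?d. poly (pderiv (pderiv (cheb j))) x *\<^sub>R (v j /\<^sub>R ?r /\<^sub>R ?r))
      = (\<Sum>l=0..N. poly (cheb l) x *\<^sub>R q l)" for x
  proof -
    let ?E = "\<lambda>j. poly (pderiv (pderiv (cheb j))) x"
    have "(\<Sum>j=0..?d. ?E j *\<^sub>R (v j /\<^sub>R ?r /\<^sub>R ?r)) = (\<Sum>j=2..?d. ?E j *\<^sub>R (v j /\<^sub>R ?r /\<^sub>R ?r))"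
      unfolding split0 split1 by (simp add: pderiv_pCons del: sum.cl_ivl_Suc)
    also have "\<dots> = (\<Sum>j=2..?d. \<Sum>l=0..N. (ZN N l j * ?E j) *\<^sub>R q l)"
    proof (intro sum.cong refl)
      fix j assume j: "j \<in> {2..?d}"
      have "v j /\<^sub>R ?r /\<^sub>R ?r = (\<Sum>l=0..N. ZN N l j *\<^sub>R q l)"
        unfolding v[OF j] using horizon_pos by (simp add: power2_eq_square field_simps)
      then show "?E j *\<^sub>R (v j /\<^sub>R ?r /\<^sub>R ?r) = (\<Sum>l=0..N. (ZN N l j * ?E j) *\<^sub>R q l)"
        by (simp add: scaleR_sum_right mult.commute)
    qed
    also have "\<dots> = (\<Sum>l=0..N. (\<Sum>j=2..?d. ZN N l j * ?E j) *\<^sub>R q l)"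
      by (subst sum.swap) (simp add: scaleR_sum_left del: sum.cl_ivl_Suc)
    also have "\<dots> = (\<Sum>l=0..N. poly (cheb l) x *\<^sub>R q l)"
      by (intro sum.cong refl) (simp only: sum_ZN_pderiv2_cheb atLeastAtMost_iff)
    finally show ?thesis .
  qed
  then show "opR0 K \<tau> (cheb_sum ?r ?d v) = cheb_sum ?r N q"
    unfolding cheb_sum_eq_poly_sum opR0_def D2 unfolding poly_sum_def by simp
qed

end

theorem theorem4p1:
  fixes K N :: nat
    and \<tau> :: "nat \<Rightarrow> real"
    and H :: "int \<Rightarrow> real^('n::finite + 'n)^('n + 'n)"
    and q :: "nat \<Rightarrow> real^('n + 'n)"
  assumes "1 \<le> K"
    and "0 < \<tau> 1"
    and "strict_mono_on {1..K} \<tau>"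
    and "transpose (symplJ ** H 0) = symplJ ** H 0"
    and "\<forall>k\<in>{1..K}. transpose (symplJ ** H (- int k)) = symplJ ** H (int k)"
    and "\<not> eigenvalue_opH K \<tau> H 0"
  shows "invertible (charM K \<tau> H 0)
    \<and> bij_betw (opR0 K \<tau>) (domR0 K \<tau> H) (CX (\<tau> K))
    \<and> cheb_sum (\<tau> K) N q \<in> CX (\<tau> K)
    \<and> (\<exists>v. coeff_eqs K \<tau> H N q v)
    \<and> (\<forall>v. coeff_eqs K \<tau> H N q v \<longleftrightarrow>
          the_inv_into (domR0 K \<tau> H) (opR0 K \<tau>) (cheb_sum (\<tau> K) N q)
            = cheb_sum (\<tau> K) (N + 2) v)"
proof -
  interpret delays K \<tau> H using assms(1-3) by unfold_locales
  note inv = invertible_charM_0[OF assms(6)]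
  note bij = bij_betw_opR0[OF inv]
  let ?\<phi> = "the_inv_into (domR0 K \<tau> H) (opR0 K \<tau>) (cheb_sum (\<tau> K) N q)"
  \<comment> \<open>The left side of the equivalence implies the right by injectivity of \<open>\<R>\<^sub>0\<close>; for the converse,
    an expansion of the inverse image is compared with that of one solution \<open>w\<close>.\<close>
  have sol: "?\<phi> = cheb_sum (\<tau> K) (N + 2) v" if "coeff_eqs K \<tau> H N q v" for v
    using the_inv_into_f_eq[OF bij_betw_imp_inj_on[OF bij]] coeff_eqs_solves[OF that] by blast
  obtain w where w: "coeff_eqs K \<tau> H N q w" using coeff_eqs_exists[OF inv] by blast
  have "coeff_eqs K \<tau> H N q v" if "?\<phi> = cheb_sum (\<tau> K) (N + 2) v" for v
  proof (rule coeff_eqs_cong[OF w])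
    have "cheb_sum (\<tau> K) (N + 2) w = cheb_sum (\<tau> K) (N + 2) v" using sol[OF w] that by simp
    then show "w l = v l" if "l \<le> N + 2" for l
      using cheb_sum_inject[OF horizon_pos] that by blast
  qed
  with sol have "\<forall>v. coeff_eqs K \<tau> H N q v \<longleftrightarrow> ?\<phi> = cheb_sum (\<tau> K) (N + 2) v" by blast
  moreover have "cheb_sum (\<tau> K) N q \<in> CX (\<tau> K)" by (simp add: cheb_sum_eq_poly_sum poly_sum_CX)
  ultimately show ?thesis using inv bij w by blast
qed

end
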